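(* Let $\Delta=\{z\in\mathbb{C}:|z|\le 1\}$ and $\Gamma=\{z\in\mathbb{C}:|z|=1\}$. Let $\varphi$ be a continuous complex-valued function on $\Delta$ whose restriction to $\Gamma$ is real analytic (i.e. $\theta\mapsto\varphi(e^{i\theta})$ is a real-analytic function of $\theta\in\mathbb{R}$). Let $$\mathfrak{M}=\{a+b\varphi:\ a,b\in\mathfrak{A}_0\}\subset C(\Delta).$$ Assume that for each $x\in\operatorname{int}\Delta$ there exists a constant $M_x<\infty$ such that $$|f(x)|\le M_x\cdot\sup_{\Gamma}|f|\qquad\text{for all } f\in\mathfrak{M}.$$ Then $\varphi$ is holomorphic in $\operatorname{int}\Delta$ (and hence every function in $\mathfrak{M}$ is holomorphic in $\operatorname{int}\Delta$).
   Context: $\mathfrak{A}_0$ denotes the disk algebra: the algebra of all complex-valued functions continuous on the closed unit disk $\Delta$ and holomorphic in its interior $\operatorname{int}\Delta=\{|z|<1\}$. *)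

theory Defs
  imports "HOL-Complex_Analysis.Complex_Analysis"
begin

definition real_analytic :: "(real \<Rightarrow> complex) \<Rightarrow> bool" where
  "real_analytic g \<longleftrightarrow>
     (\<forall>t0. \<exists>r>0. \<exists>c :: nat \<Rightarrow> complex.
        \<forall>t. \<bar>t - t0\<bar> < r \<longrightarrow> (\<lambda>n. c n * of_real ((t - t0) ^ n)) sums g t)"

definition disk_algebra :: "(complex \<Rightarrow> complex) set" where
  "disk_algebra = {f. continuous_on (cball 0 1) f \<and> f holomorphic_on ball 0 1}"

definition module_M :: "(complex \<Rightarrow> complex) \<Rightarrow> (complex \<Rightarrow> complex) set" where
  "module_M \<phi> = {(\<lambda>z. a z + b z * \<phi> z) | a b. a \<in> disk_algebra \<and> b \<in> disk_algebra}"

end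

theory Submission
  imports Defs
begin

text \<open>
  Real analyticity continues \<open>\<phi>\<close> from the circle to a holomorphic \<open>\<Phi>\<close> on an annulus, so every \<open>b \<Phi>\<close>
  with \<open>b\<close> holomorphic past the closed disc splits into a part \<open>a\<close> in the disk algebra and a principal part.
  Since \<open>b \<phi> - a\<close> lies in the module and equals the principal part on the circle, the hypothesis bounds
  \<open>b(x) \<phi>(x) - a(x)\<close> by the negative Laurent coefficients of \<open>b \<Phi>\<close>.
  At \<open>x = 0\<close>, applied to \<open>z b(z)\<close>, this says that the first row of the Hankel matrix of negative Laurent
  coefficients of \<open>\<Phi>\<close> is dominated, as a functional, by the sum of the other rows; by duality
  it is a combination of them with bounded coefficients \<open>k n\<close>.
  Then \<open>q(z) = 1 - \<Sum>n. k n z^(n+1)\<close> is holomorphic in the open disc and \<open>q \<Phi>\<close> has no principal part.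
  Applying the bound at every \<open>x\<close> to the partial sums of \<open>q\<close> shows that \<open>q \<phi>\<close> is holomorphic, and
  the zeros of \<open>q\<close> are removable because \<open>\<phi>\<close> is continuous.
\<close>

subsection \<open>Duality for Hankel rows\<close>

text \<open>A majorant of product form makes the family absolutely summable over pairs of indices,
  so Fubini for \<open>infsum\<close> applies; the rest translates between \<open>suminf\<close> and
  \<open>infsum\<close>.\<close>

lemma double_suminf_swap:
  fixes a :: "nat \<Rightarrow> nat \<Rightarrow> 'a::banach"
  assumes bd: "\<And>n j. norm (a n j) \<le> u n * v j" and u: "summable u" and v: "summable v"
  shows "(\<Sum>n. \<Sum>j. a n j) = (\<Sum>j. \<Sum>n. a n j)"
proof -
  have row: "summable (\<lambda>j. norm (a n j))" for n
    by (rule summable_comparison_test'[where g = "\<lambda>j. u n * v j" and N = 0])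
      (use bd v in \<open>auto intro: summable_mult\<close>)
  have col: "summable (\<lambda>n. norm (a n j))" for j
    by (rule summable_comparison_test'[where g = "\<lambda>n. u n * v j" and N = 0])
      (use bd u in \<open>auto intro: summable_mult2\<close>)
  have row': "(a n) summable_on UNIV" for n
    by (rule norm_summable_imp_summable_on[OF row])
  have col': "(\<lambda>n. a n j) summable_on UNIV" for j
    by (rule norm_summable_imp_summable_on[OF col])
  have rown: "(\<lambda>j. norm (a n j)) summable_on UNIV" for n
    by (rule norm_summable_imp_summable_on) (use row in auto)
  have rs: "norm (suminf (\<lambda>j. norm (a n j))) \<le> u n * suminf v" for n
  proof -
    have "(\<Sum>j. norm (a n j)) \<le> (\<Sum>j. u n * v j)"
      by (rule suminf_le) (use bd row v in \<open>auto intro: summable_mult\<close>)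
    also have "\<dots> = u n * suminf v" using v by (rule suminf_mult)
    finally show ?thesis using row by (simp add: suminf_nonneg)
  qed
  have inf_row: "infsum (\<lambda>j. norm (a n j)) UNIV = suminf (\<lambda>j. norm (a n j))" for n
    using has_sum_imp_sums[OF has_sum_infsum[OF rown]] sums_unique by fastforce
  have "(\<lambda>n. norm (suminf (\<lambda>j. norm (a n j)))) summable_on UNIV"
    by (rule norm_summable_imp_summable_on, rule summable_comparison_test'[where g = "\<lambda>n. u n * suminf v" and N = 0])
      (use rs u in \<open>auto intro: summable_mult2\<close>)
  then have "(\<lambda>p. norm (case p of (n, j) \<Rightarrow> a n j)) summable_on (UNIV \<times> UNIV)"
    by (subst Infinite_Sum.abs_summable_on_Sigma_iff) (auto simp: inf_row rown)
  then have sm: "(\<lambda>(n, j). a n j) summable_on (UNIV \<times> UNIV)"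
    by (rule abs_summable_summable)
  have i1: "infsum (a n) UNIV = suminf (a n)" for n
    using has_sum_imp_sums[OF has_sum_infsum[OF row']] sums_unique by fastforce
  have i2: "infsum (\<lambda>n. a n j) UNIV = (\<Sum>n. a n j)" for j
    using has_sum_imp_sums[OF has_sum_infsum[OF col']] sums_unique by fastforce
  have s1: "(\<lambda>n. infsum (\<lambda>j. a n j) UNIV) summable_on UNIV"
    using summable_on_Sigma_banach[OF sm] by simp
  have sm2: "(\<lambda>(j, n). a n j) summable_on (UNIV \<times> UNIV)"
    using summable_on_swap[of "\<lambda>(n,j). a n j" UNIV UNIV] sm by (simp add: case_prod_unfold)
  have s2: "(\<lambda>j. infsum (\<lambda>n. a n j) UNIV) summable_on UNIV"
    using summable_on_Sigma_banach[OF sm2] by simp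
  have "(\<Sum>n. \<Sum>j. a n j) = infsum (\<lambda>n. infsum (\<lambda>j. a n j) UNIV) UNIV"
    using has_sum_imp_sums[OF has_sum_infsum[OF s1]] sums_unique unfolding i1 by fastforce
  also have "\<dots> = infsum (\<lambda>j. infsum (\<lambda>n. a n j) UNIV) UNIV"
    by (rule infsum_swap_banach[OF sm])
  also have "\<dots> = (\<Sum>j. \<Sum>n. a n j)"
    using has_sum_imp_sums[OF has_sum_infsum[OF s2]] sums_unique unfolding i2 by fastforce
  finally show ?thesis .
qed

text \<open>Tychonoff's theorem: the type \<open>nat \<Rightarrow> complex\<close> carries the
  topology of coordinatewise convergence.\<close>

lemma compact_coordinate_discs: "compact {k :: nat \<Rightarrow> complex. \<forall>n. cmod (k n) \<le> M}"
proof -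
  have "compactin (product_topology (\<lambda>_. euclidean) UNIV) (PiE UNIV (\<lambda>_::nat. cball (0::complex) M))"
    by (subst compactin_PiE) auto
  then have "compact (PiE UNIV (\<lambda>_::nat. cball (0::complex) M))"
    by (simp add: euclidean_product_topology)
  moreover have "PiE UNIV (\<lambda>_::nat. cball (0::complex) M) = {k. \<forall>n. cmod (k n) \<le> M}"
    by (auto simp: PiE_def Pi_def)
  ultimately show ?thesis by simp
qed

lemma continuous_on_suminf:
  fixes f :: "nat \<Rightarrow> 'a::topological_space \<Rightarrow> 'b::banach"
  assumes "\<And>n. continuous_on S (f n)" "\<And>n x. x \<in> S \<Longrightarrow> norm (f n x) \<le> B n" "summable B"
  shows "continuous_on S (\<lambda>x. \<Sum>n. f n x)"
  by (rule uniform_limit_theorem[OF _ Weierstrass_m_test[OF assms(2,3)]])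
    (auto intro!: always_eventually continuous_on_sum assms(1))

text \<open>The first-order condition at a minimum, as if dividing by \<open>t\<close> and letting
  it tend to zero. The range \<open>t \<le> 1\<close> suits a variation along a segment inside a
  convex set.\<close>

lemma quadratic_nonneg_imp:
  fixes S Q :: real
  assumes "\<And>t. 0 < t \<Longrightarrow> t \<le> 1 \<Longrightarrow> 0 \<le> t\<^sup>2 * Q - 2 * t * S"
  shows "S \<le> 0"
proof (rule ccontr)
  assume "\<not> S \<le> 0"
  \<comment> \<open>This denominator gives both \<open>t \<le> 1\<close> and
    \<open>t * Q \<le> S\<close>, so \<open>t * Q - 2 * S\<close> is at most \<open>- S\<close> and
    hence negative.\<close>
  define t where "t = S / (S + \<bar>Q\<bar>)"
  have t: "0 < t" "t \<le> 1" using \<open>\<not> S \<le> 0\<close> by (auto simp: t_def divide_simps)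
  have "t * Q \<le> t * (S + \<bar>Q\<bar>)" using t \<open>\<not> S \<le> 0\<close> by (intro mult_left_mono) auto
  also have "\<dots> = S" using \<open>\<not> S \<le> 0\<close> by (simp add: t_def)
  finally have "t * (t * Q - 2 * S) < 0" using t \<open>\<not> S \<le> 0\<close> by (simp add: mult_pos_neg)
  then show False using assms[OF t] by (simp add: power2_eq_square algebra_simps)
qed

text \<open>
  The coefficients are found by minimising the square sum of the residuals \<open>e k j\<close> over the compact product of
  discs of radius \<open>M\<close>; if the minimum were positive, the conjugate residuals would violate \<open>bound\<close>.
\<close>

lemma hankel_duality:
  fixes c :: "nat \<Rightarrow> complex"
  assumes r: "0 < r" "r < 1" and M: "0 \<le> M"
    and c: "\<And>m. cmod (c m) \<le> C * r ^ m"
    and bound: "\<And>b B. (\<And>j. cmod (b j) \<le> B * r ^ j) \<Longrightarrow>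
      cmod (\<Sum>j. b j * c j) \<le> M * (\<Sum>n. cmod (\<Sum>j. b j * c (Suc n + j)))"
  obtains k where "\<And>n. cmod (k n) \<le> M" "\<And>j. (\<lambda>n. k n * c (Suc n + j)) sums c j"
proof -
  define K where "K = {k :: nat \<Rightarrow> complex. \<forall>n. cmod (k n) \<le> M}"
  define e where "e k j = c j - (\<Sum>n. k n * c (Suc n + j))" for k j
  define F where "F k = (\<Sum>j. (cmod (e k j))\<^sup>2)" for k
  have C0: "0 \<le> C" using order_trans[OF norm_ge_zero c[of 0]] by simp
  have sr: "summable (\<lambda>n. r ^ n)" using r by (simp add: summable_geometric)
  have tbd: "cmod (m n * c (Suc n + j)) \<le> (N * C * r ^ j) * r ^ n" if "\<And>n. cmod (m n) \<le> N" for m n j N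
  proof -
    have N0: "0 \<le> N" using order_trans[OF norm_ge_zero that[of 0]] .
    have "cmod (m n * c (Suc n + j)) \<le> N * (C * r ^ (Suc n + j))"
      unfolding norm_mult using that c[of "Suc n + j"] N0 by (intro mult_mono) auto
    also have "\<dots> \<le> N * (C * r ^ (n + j))"
      using N0 C0 r by (intro mult_left_mono power_decreasing) auto
    finally show ?thesis by (simp add: power_add mult_ac)
  qed
  have summ: "summable (\<lambda>n. m n * c (Suc n + j))" if "\<And>n. cmod (m n) \<le> N" for m j N
    by (rule summable_comparison_test'[where g = "\<lambda>n. (N * C * r ^ j) * r ^ n" and N = 0])
      (use tbd[of m N, OF that] sr in \<open>auto intro: summable_mult\<close>)
  have hbd: "cmod (\<Sum>n. m n * c (Suc n + j)) \<le> (N * C / (1 - r)) * r ^ j" if "\<And>n. cmod (m n) \<le> N" for m j N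
  proof -
    have "cmod (\<Sum>n. m n * c (Suc n + j)) \<le> (\<Sum>n. (N * C * r ^ j) * r ^ n)"
      by (rule norm_suminf_le) (use tbd[of m N, OF that] sr in \<open>auto intro: summable_mult\<close>)
    also have "\<dots> = (N * C / (1 - r)) * r ^ j"
      using r by (simp add: suminf_mult sr suminf_geometric)
    finally show ?thesis .
  qed
  define E where "E = C + M * C / (1 - r)"
  have ebd: "cmod (e k j) \<le> E * r ^ j" if "k \<in> K" for k j
  proof -
    have "cmod (e k j) \<le> cmod (c j) + cmod (\<Sum>n. k n * c (Suc n + j))"
      unfolding e_def by (rule norm_triangle_ineq4)
    also have "\<dots> \<le> C * r ^ j + (M * C / (1 - r)) * r ^ j"
      using c[of j] hbd[of k M j] that by (intro add_mono) (auto simp: K_def)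
    finally show ?thesis by (simp add: E_def algebra_simps)
  qed
  have sr2: "summable (\<lambda>n. A * (r ^ n)\<^sup>2)" for A :: real
  proof -
    have "(r ^ n)\<^sup>2 = (r\<^sup>2) ^ n" for n by (simp add: power_mult [symmetric] mult.commute)
    moreover have "r\<^sup>2 < 1" using r by (simp add: power_less_one_iff)
    ultimately show ?thesis by (auto intro!: summable_mult summable_geometric)
  qed
  have prodsum: "summable (\<lambda>j. x j * y j)" if "\<And>j. cmod (x j) \<le> X * r ^ j" "\<And>j. cmod (y j) \<le> Y * r ^ j"
    for x y :: "nat \<Rightarrow> complex" and X Y
  proof (rule summable_comparison_test'[where g = "\<lambda>j. (X * Y) * (r ^ j)\<^sup>2" and N = 0])
    show "norm (x j * y j) \<le> (X * Y) * (r ^ j)\<^sup>2" for j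
    proof -
      have "0 \<le> X * r ^ j" using order_trans[OF norm_ge_zero that(1)] .
      then have "norm (x j * y j) \<le> (X * r ^ j) * (Y * r ^ j)"
        unfolding norm_mult using that by (intro mult_mono) auto
      then show ?thesis by (simp add: power2_eq_square mult_ac)
    qed
  qed (rule sr2)
  have Fsq: "summable (\<lambda>j. (cmod (x j))\<^sup>2)" if "\<And>j. cmod (x j) \<le> X * r ^ j" for x :: "nat \<Rightarrow> complex" and X
    by (rule summable_comparison_test'[where g = "\<lambda>j. X\<^sup>2 * (r ^ j)\<^sup>2" and N = 0])
      (use power_mono[OF that] sr2 in \<open>auto simp: power_mult_distrib\<close>)
  have coord: "continuous_on K (\<lambda>k. k n)" for n
    by (rule continuous_on_subset[OF continuous_on_product_coordinates]) simp
  have conte: "continuous_on K (\<lambda>k. e k j)" for j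
    unfolding e_def
  proof (rule continuous_on_diff[OF continuous_on_const],
      rule continuous_on_suminf[where B = "\<lambda>n. (M * C * r ^ j) * r ^ n"])
    show "continuous_on K (\<lambda>k. k n * c (Suc n + j))" for n
      by (rule continuous_on_mult[OF coord continuous_on_const])
    show "cmod (k n * c (Suc n + j)) \<le> (M * C * r ^ j) * r ^ n" if "k \<in> K" for n k
      by (rule tbd) (use that in \<open>auto simp: K_def\<close>)
  qed (rule summable_mult[OF sr])
  have "continuous_on K F"
    unfolding F_def
  proof (rule continuous_on_suminf)
    show "continuous_on K (\<lambda>k. (cmod (e k j))\<^sup>2)" for j
      by (rule continuous_on_power[OF continuous_on_norm[OF conte]])
    show "norm ((cmod (e k j))\<^sup>2) \<le> E\<^sup>2 * (r ^ j)\<^sup>2" if "k \<in> K" for j k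
      using power_mono[OF ebd[OF that, of j], of 2] by (simp add: power_mult_distrib)
  qed (rule sr2)
  moreover have "compact K" unfolding K_def by (rule compact_coordinate_discs)
  moreover have "K \<noteq> {}" using M by (auto simp: K_def intro!: exI[of _ "\<lambda>_. 0"])
  ultimately obtain k where k: "k \<in> K" and kmin: "\<And>k'. k' \<in> K \<Longrightarrow> F k \<le> F k'"
    using continuous_attains_inf[of K F] by blast
  have kM: "\<And>n. cmod (k n) \<le> M" using k by (simp add: K_def)
  \<comment> \<open>The test sequence for \<open>bound\<close>: its pairing with the residual
    \<open>e k\<close> is \<open>F k\<close>, and it inherits the decay \<open>r ^ j\<close> of the
    residual.\<close>
  define b where "b j = cnj (e k j)" for j
  have bb: "cmod (b j) \<le> E * r ^ j" for j using ebd[OF k] by (simp add: b_def)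
  define D where "D n = (\<Sum>j. b j * c (Suc n + j))" for n
  \<comment> \<open>Interchanging the two sums: pairing \<open>b\<close> with a combination of the
    shifted rows gives the same combination of the pairings \<open>D n\<close>.\<close>
  have swap: "(\<Sum>j. b j * (\<Sum>n. m n * c (Suc n + j))) = (\<Sum>n. m n * D n)" (is ?A)
    and sumD: "summable (\<lambda>n. m n * D n)" (is ?B) if m: "\<And>n. cmod (m n) \<le> N" for m N
  proof -
    have N0: "0 \<le> N" using order_trans[OF norm_ge_zero m[of 0]] .
    have E0: "0 \<le> E" using order_trans[OF norm_ge_zero bb[of 0]] by simp
    have t: "norm (b j * (m n * c (Suc n + j))) \<le> (E * (r ^ j)\<^sup>2) * (N * C * r ^ n)" for j n
    proof -
      have "norm (b j * (m n * c (Suc n + j))) \<le> (E * r ^ j) * ((N * C * r ^ j) * r ^ n)"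
        unfolding norm_mult[of "b j"] using E0 r by (intro mult_mono bb tbd m) auto
      then show ?thesis by (simp add: power2_eq_square mult_ac)
    qed
    have "(\<Sum>j. b j * (\<Sum>n. m n * c (Suc n + j))) = (\<Sum>j. \<Sum>n. b j * (m n * c (Suc n + j)))"
      by (subst suminf_mult) (use summ[of m N, OF m] in auto)
    also have "\<dots> = (\<Sum>n. \<Sum>j. b j * (m n * c (Suc n + j)))"
      by (rule double_suminf_swap[OF t sr2]) (use sr in \<open>auto intro: summable_mult\<close>)
    also have "(\<lambda>n. \<Sum>j. b j * (m n * c (Suc n + j))) = (\<lambda>n. m n * D n)"
    proof
      fix n
      have "summable (\<lambda>j. b j * c (Suc n + j))"
      proof (rule prodsum[OF bb])
        show "cmod (c (Suc n + j)) \<le> C * r ^ j" for j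
          using c[of "Suc n + j"] C0 r mult_left_mono[OF power_decreasing[of j "Suc n + j" r], of C] by force
      qed
      then show "(\<Sum>j. b j * (m n * c (Suc n + j))) = m n * D n"
        unfolding D_def by (subst suminf_mult [symmetric]) (auto simp: mult_ac)
    qed
    finally show ?A .
    show ?B
    proof (rule summable_comparison_test'[where g = "\<lambda>n. (\<Sum>j. E * (r ^ j)\<^sup>2) * (N * C * r ^ n)" and N = 0])
      show "summable (\<lambda>n. (\<Sum>j. E * (r ^ j)\<^sup>2) * (N * C * r ^ n))"
        using sr by (auto intro: summable_mult)
      fix n
      have "norm (m n * D n) = norm (\<Sum>j. b j * (m n * c (Suc n + j)))"
        using \<open>(\<lambda>n. \<Sum>j. b j * (m n * c (Suc n + j))) = (\<lambda>n. m n * D n)\<close> by metis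
      also have "\<dots> \<le> (\<Sum>j. (E * (r ^ j)\<^sup>2) * (N * C * r ^ n))"
        by (rule norm_suminf_le[OF t]) (rule summable_mult2[OF sr2])
      also have "\<dots> = (\<Sum>j. E * (r ^ j)\<^sup>2) * (N * C * r ^ n)"
        by (rule suminf_mult2[symmetric, OF sr2])
      finally show "norm (m n * D n) \<le> (\<Sum>j. E * (r ^ j)\<^sup>2) * (N * C * r ^ n)" .
    qed
  qed
  \<comment> \<open>Among coefficients of modulus at most \<open>M\<close> these make the pairing
    with \<open>D\<close> largest: each \<open>k' n * D n\<close> is \<open>M\<close> times the
    modulus of \<open>D n\<close>, which sums to the right side of \<open>bound\<close>.\<close>
  define k' where "k' n = of_real M * cnj (sgn (D n))" for n
  have k'M: "cmod (k' n) \<le> M" for n using M by (simp add: k'_def norm_mult norm_sgn)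
  have k'D: "k' n * D n = of_real (M * cmod (D n))" for n
  proof (cases "D n = 0")
    case False
    have "k' n * D n = of_real M * ((D n * cnj (D n)) / of_real (cmod (D n)))"
      by (simp add: k'_def sgn_eq)
    also have "D n * cnj (D n) = of_real (cmod (D n)) * of_real (cmod (D n))"
      by (simp only: complex_norm_square [symmetric] power2_eq_square of_real_mult)
    finally show ?thesis using False by simp
  qed simp
  define h where "h j = (\<Sum>n. (k' n - k n) * c (Suc n + j))" for j
  have dM: "cmod (k' n - k n) \<le> 2 * M" for n
    using norm_triangle_ineq4[of "k' n" "k n"] k'M[of n] kM[of n] by linarith
  note hb = hbd[of "\<lambda>n. k' n - k n", OF dM, folded h_def]
  \<comment> \<open>Moving from \<open>k\<close> towards \<open>k'\<close> stays in \<open>K\<close>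
    by convexity and changes the residual by \<open>- t * h\<close>; minimality of
    \<open>F k\<close> then fixes the sign of the first-order term.\<close>
  have variation: "Re (\<Sum>j. b j * h j) \<le> 0"
  proof (rule quadratic_nonneg_imp)
    fix t :: real
    assume t: "0 < t" "t \<le> 1"
    define kt where "kt n = k n + of_real t * (k' n - k n)" for n
    have "kt \<in> K"
      unfolding K_def
    proof (intro CollectI allI)
      fix n
      have "kt n = of_real (1 - t) * k n + of_real t * k' n" by (simp add: kt_def algebra_simps)
      then have "cmod (kt n) \<le> cmod (of_real (1 - t) * k n) + cmod (of_real t * k' n)"
        by (metis norm_triangle_ineq)
      also have "\<dots> = (1 - t) * cmod (k n) + t * cmod (k' n)"
        using t by (simp only: norm_mult norm_of_real)
      also have "\<dots> \<le> (1 - t) * M + t * M"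
        using t kM k'M by (intro add_mono mult_left_mono) auto
      finally show "cmod (kt n) \<le> M" by (simp add: algebra_simps)
    qed
    have "e kt j = e k j - of_real t * h j" for j
    proof -
      have "(\<Sum>n. kt n * c (Suc n + j)) = (\<Sum>n. k n * c (Suc n + j) + of_real t * ((k' n - k n) * c (Suc n + j)))"
        by (simp add: kt_def algebra_simps)
      also have "\<dots> = (\<Sum>n. k n * c (Suc n + j)) + (\<Sum>n. of_real t * ((k' n - k n) * c (Suc n + j)))"
        by (intro suminf_add [symmetric] summ[of k, OF kM] summable_mult summ[of "\<lambda>n. k' n - k n", OF dM])
      also have "(\<Sum>n. of_real t * ((k' n - k n) * c (Suc n + j))) = of_real t * h j"
        unfolding h_def by (rule suminf_mult[OF summ[of "\<lambda>n. k' n - k n", OF dM]])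
      finally show ?thesis by (simp add: e_def)
    qed
    then have ekt: "(cmod (e kt j))\<^sup>2 = (cmod (e k j))\<^sup>2 + (t\<^sup>2 * (cmod (h j))\<^sup>2 - 2 * t * Re (b j * h j))" for j
      by (simp add: b_def cmod_power2) (simp add: power2_eq_square algebra_simps)
    have s1: "summable (\<lambda>j. (cmod (e k j))\<^sup>2)" by (rule Fsq[OF ebd[OF k]])
    have s2: "summable (\<lambda>j. (cmod (h j))\<^sup>2)" by (rule Fsq[OF hb])
    have s3: "summable (\<lambda>j. b j * h j)" by (rule prodsum[OF bb hb])
    note s3' = summable_Re[OF s3]
    have "F kt = F k + (t\<^sup>2 * (\<Sum>j. (cmod (h j))\<^sup>2) - 2 * t * (\<Sum>j. Re (b j * h j)))"
      unfolding F_def ekt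
      by (intro sums_unique [symmetric] sums_add sums_diff sums_mult summable_sums s1 s2 s3')
    with kmin[OF \<open>kt \<in> K\<close>]
    show "0 \<le> t\<^sup>2 * (\<Sum>j. (cmod (h j))\<^sup>2) - 2 * t * Re (\<Sum>j. b j * h j)"
      by (simp add: Re_suminf[OF s3])
  qed
  have cr: "cmod (c j) \<le> C * r ^ j" for j by (rule c)
  \<comment> \<open>The first variation is the pairing of \<open>k'\<close> with \<open>D\<close>,
    minus the pairing of \<open>b\<close> with \<open>c\<close>, plus \<open>F k\<close>. By
    \<open>bound\<close> the first has real part at least that of the second, so a nonpositive
    variation forces \<open>F k \<le> 0\<close>.\<close>
  have "(\<Sum>j. b j * h j) = (\<Sum>n. (k' n - k n) * D n)"
    unfolding h_def by (rule swap[OF dM])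
  also have "\<dots> = (\<Sum>n. k' n * D n) - (\<Sum>n. k n * D n)"
    unfolding left_diff_distrib by (intro suminf_diff [symmetric] sumD[of k', OF k'M] sumD[of k, OF kM])
  also have "(\<Sum>n. k n * D n) = (\<Sum>j. b j * (c j - e k j))"
    unfolding swap[of k, OF kM, symmetric] e_def by simp
  also have "\<dots> = (\<Sum>j. b j * c j) - (\<Sum>j. b j * e k j)"
    unfolding right_diff_distrib by (intro suminf_diff [symmetric] prodsum[OF bb cr] prodsum[OF bb ebd[OF k]])
  also have "(\<Sum>j. b j * e k j) = (\<Sum>j. of_real ((cmod (e k j))\<^sup>2))"
    by (intro suminf_cong) (simp only: b_def complex_norm_square mult.commute)
  also have "\<dots> = of_real (F k)"
    unfolding F_def by (rule suminf_of_real[OF Fsq[OF ebd[OF k]], symmetric])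
  finally have eq: "(\<Sum>j. b j * h j) = (\<Sum>n. k' n * D n) - ((\<Sum>j. b j * c j) - of_real (F k))" .
  have "summable (\<lambda>n. Re (k' n * D n))" by (intro summable_Re sumD[of k', OF k'M])
  then have sMD: "summable (\<lambda>n. M * cmod (D n))" by (simp add: k'D)
  have "Re (\<Sum>n. k' n * D n) = (\<Sum>n. M * cmod (D n))"
    by (simp add: k'D Re_suminf[OF sumD[of k', OF k'M], unfolded k'D] del: of_real_mult)
  also have "\<dots> = M * (\<Sum>n. cmod (D n))"
  proof (cases "M = 0")
    case False
    then have "summable (\<lambda>n. cmod (D n))" using sMD by (simp add: summable_mult_D)
    then show ?thesis by (rule suminf_mult)
  qed simp
  also have "\<dots> \<ge> cmod (\<Sum>j. b j * c j)" unfolding D_def by (rule bound[OF bb])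
  finally have "Re (\<Sum>n. k' n * D n) \<ge> Re (\<Sum>j. b j * c j)"
    using complex_Re_le_cmod order_trans by blast
  with variation eq have "F k \<le> 0" by simp
  have "e k j = 0" for j
  proof (rule ccontr)
    assume "e k j \<noteq> 0"
    then have "0 < F k" unfolding F_def
      by (intro suminf_pos2[OF Fsq[OF ebd[OF k]], of j]) auto
    then show False using \<open>F k \<le> 0\<close> by simp
  qed
  then have "(\<Sum>n. k n * c (Suc n + j)) = c j" for j
    unfolding e_def right_minus_eq by (rule sym)
  moreover have "(\<lambda>n. k n * c (Suc n + j)) sums (\<Sum>n. k n * c (Suc n + j))" for j
    by (rule summable_sums[OF summ[OF kM]])
  ultimately have "(\<lambda>n. k n * c (Suc n + j)) sums c j" for j by (simp only:)
  then show ?thesis by (rule that[OF kM])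
qed

subsection \<open>Circle integrals and Laurent splitting\<close>

definition circ :: "real \<Rightarrow> (complex \<Rightarrow> complex) \<Rightarrow> complex" where
  "circ t f = contour_integral (circlepath 0 t) f / (2 * of_real pi * \<i>)"

abbreviation annulus :: "real \<Rightarrow> real \<Rightarrow> complex set" where
  "annulus r s \<equiv> {z. r < cmod z \<and> cmod z < s}"

lemma open_annulus: "open (annulus r s)"
  by (intro open_Collect_conj open_Collect_less continuous_intros)

lemma circ_cong: "\<lbrakk>\<And>w. cmod w = t \<Longrightarrow> f w = g w; 0 < t\<rbrakk> \<Longrightarrow> circ t f = circ t g"
  unfolding circ_def by (subst contour_integral_eq[of "circlepath 0 t" f g]) auto

lemma contour_integrable_circle:
  "\<lbrakk>continuous_on (sphere 0 t) f; 0 < t\<rbrakk> \<Longrightarrow> f contour_integrable_on circlepath 0 t"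
  by (intro contour_integrable_continuous_circlepath) auto

lemma norm_circ_le:
  assumes "continuous_on (sphere 0 t) f" "0 < t" "\<And>w. cmod w = t \<Longrightarrow> cmod (f w) \<le> B"
  shows "cmod (circ t f) \<le> B * t"
proof -
  have "0 \<le> B"
    by (rule order_trans[OF norm_ge_zero assms(3)[of "of_real t"]]) (use assms(2) in simp)
  then have "cmod (contour_integral (circlepath 0 t) f) \<le> B * (2 * pi * t)"
    by (intro has_contour_integral_bound_circlepath[OF has_contour_integral_integral[OF contour_integrable_circle]])
      (use assms in auto)
  then show ?thesis by (simp add: circ_def norm_divide norm_mult divide_simps mult_ac)
qed

text \<open>The linear homotopy between concentric circles keeps each point on its ray, at a modulus
  that is a convex combination of \<open>s\<close> and \<open>t\<close>, so it never leaves the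
  annulus.\<close>

lemma circ_eq:
  assumes f: "f holomorphic_on annulus r1 r2" and "0 \<le> r1"
    and s: "r1 < s" "s < r2" and t: "r1 < t" "t < r2"
  shows "circ s f = circ t f"
proof -
  have "homotopic_loops (annulus r1 r2) (circlepath 0 s) (circlepath 0 t)"
  proof (rule homotopic_loops_linear)
    fix u :: real
    show "closed_segment (circlepath 0 s u) (circlepath 0 t u) \<subseteq> annulus r1 r2"
    proof
      fix z assume "z \<in> closed_segment (circlepath 0 s u) (circlepath 0 t u)"
      then obtain v where v: "0 \<le> v" "v \<le> 1" and z: "z = (1 - v) *\<^sub>R circlepath 0 s u + v *\<^sub>R circlepath 0 t u"
        by (auto simp: closed_segment_def)
      define q where "q = (1 - v) * s + v * t"
      have "z = of_real q * exp (2 * of_real pi * \<i> * of_real u)"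
        by (simp add: z q_def circlepath scaleR_conv_of_real algebra_simps)
      then have nz: "cmod z = \<bar>q\<bar>"
        by (simp only: norm_mult norm_of_real) (simp add: norm_exp_eq_Re)
      have "min s t \<le> q"
        unfolding q_def using v convex_bound_le[of "-s" "- min s t" "-t" "1-v" v] by simp
      moreover have "q \<le> max s t"
        unfolding q_def using v convex_bound_le[of s "max s t" t "1-v" v] by simp
      ultimately have "r1 < q" "q < r2" using s t by linarith+
      then show "z \<in> annulus r1 r2" using nz \<open>0 \<le> r1\<close> by simp
    qed
  qed (auto simp: pathstart_circlepath pathfinish_circlepath)
  then show ?thesis
    unfolding circ_def by (subst Cauchy_theorem_homotopic_loops[OF _ open_annulus f]) auto
qed

lemma circ_suminf_LIMSEQ:
  assumes t: "0 < t" and f: "\<And>n. continuous_on (sphere 0 t) (f n)"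
    and B: "\<And>n w. cmod w = t \<Longrightarrow> cmod (f n w) \<le> B n" "summable B"
  shows "(\<lambda>N. circ t (\<lambda>w. \<Sum>n<N. f n w)) \<longlonglongrightarrow> circ t (\<lambda>w. \<Sum>n. f n w)"
proof -
  have "(\<lambda>N. contour_integral (circlepath 0 t) (\<lambda>w. \<Sum>n<N. f n w))
      \<longlonglongrightarrow> contour_integral (circlepath 0 t) (\<lambda>w. \<Sum>n. f n w)"
  proof (rule contour_integral_uniform_limit_circlepath(2))
    show "uniform_limit (sphere 0 t) (\<lambda>N w. \<Sum>n<N. f n w) (\<lambda>w. \<Sum>n. f n w) sequentially"
      by (rule Weierstrass_m_test) (use B in auto)
    show "\<forall>\<^sub>F N in sequentially. (\<lambda>w. \<Sum>n<N. f n w) contour_integrable_on circlepath 0 t"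
      using t f by (intro always_eventually allI contour_integrable_circle continuous_on_sum) auto
  qed (use t in auto)
  then show ?thesis unfolding circ_def by (intro tendsto_divide tendsto_const) auto
qed

lemma circ_sums:
  assumes t: "0 < t" and f: "\<And>n. continuous_on (sphere 0 t) (f n)"
    and B: "\<And>n w. cmod w = t \<Longrightarrow> cmod (f n w) \<le> B n" "summable B"
  shows "(\<lambda>n. circ t (f n)) sums circ t (\<lambda>w. \<Sum>n. f n w)"
proof -
  have "circ t (\<lambda>w. \<Sum>n<N. f n w) = (\<Sum>n<N. circ t (f n))" for N
    unfolding circ_def
    by (subst contour_integral_sum) (auto intro: contour_integrable_circle f t simp: sum_divide_distrib)
  then show ?thesis using circ_suminf_LIMSEQ[OF assms] by (simp add: sums_def)
qed

lemma circ_cmult: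
  assumes "continuous_on (sphere 0 t) f" "0 < t"
  shows "circ t (\<lambda>w. a * f w) = a * circ t f"
  unfolding circ_def using contour_integral_lmul[OF contour_integrable_circle[OF assms], of a] by simp

text \<open>Cauchy's formula on an annulus: the integral over a large circle gives the part
  holomorphic inside, the integral over a small circle the principal part. The outer radius stays
  free so that it can be chosen according to the point \<open>x\<close>.\<close>

lemma annulus_split:
  assumes F: "F holomorphic_on annulus r1 r2" and r: "0 \<le> r1" "r1 < r2"
  obtains a where "a holomorphic_on ball 0 r2"
    "\<And>x t. cmod x < t \<Longrightarrow> r1 < t \<Longrightarrow> t < r2 \<Longrightarrow> a x = circ t (\<lambda>w. F w / (w - x))"
    "\<And>z \<rho>. r1 < \<rho> \<Longrightarrow> \<rho> < cmod z \<Longrightarrow> cmod z < r2 \<Longrightarrow> F z = a z - circ \<rho> (\<lambda>w. F w / (w - z))"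
proof -
  \<comment> \<open>For \<open>cmod x < r2\<close> the circle of this radius surrounds
    \<open>x\<close> and lies in the annulus; \<open>aT\<close> shows that the choice of radius does
    not matter.\<close>
  define T where "T x = (max r1 (cmod x) + r2) / 2" for x :: complex
  define a where "a x = circ (T x) (\<lambda>w. F w / (w - x))" for x
  have T: "cmod x < T x" "r1 < T x" "T x < r2" if "cmod x < r2" for x
    using that r by (auto simp: T_def max_def)
  have contF: "continuous_on (sphere 0 t) F" if "r1 < t" "t < r2" for t
    by (rule holomorphic_on_imp_continuous_on[OF holomorphic_on_subset[OF F]]) (use that in auto)
  have aT: "a x = circ t (\<lambda>w. F w / (w - x))" if "cmod x < t" "r1 < t" "t < r2" for x t
    unfolding a_def
  proof (rule circ_eq)
    show "(\<lambda>w. F w / (w - x)) holomorphic_on annulus (max r1 (cmod x)) r2"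
      by (intro holomorphic_intros holomorphic_on_subset[OF F]) auto
  qed (use that T[of x] r in auto)
  have "a field_differentiable at x" if x: "x \<in> ball 0 r2" for x
  proof -
    have xT: "cmod x < T x" "r1 < T x" "T x < r2" using T[of x] x by auto
    have T0: "0 < T x" using xT r by linarith
    \<comment> \<open>Near \<open>x\<close> the circle can be frozen at radius \<open>T x\<close>,
      which presents \<open>a\<close> as a single Cauchy integral to be differentiated under the
      integral sign.\<close>
    have "((\<lambda>u. F u / (u - w) ^ 1) has_contour_integral (2 * of_real pi * \<i>) * a w) (circlepath 0 (T x))"
      if "w \<in> ball 0 (T x)" for w
    proof -
      have "continuous_on (sphere 0 (T x)) (\<lambda>u. F u / (u - w))"
        using that xT by (intro continuous_intros contF) auto
      then have "(\<lambda>u. F u / (u - w)) contour_integrable_on circlepath 0 (T x)"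
        by (rule contour_integrable_circle) (rule T0)
      moreover have "contour_integral (circlepath 0 (T x)) (\<lambda>u. F u / (u - w)) = (2 * of_real pi * \<i>) * a w"
        using aT[of w "T x"] that xT by (simp add: circ_def)
      ultimately show ?thesis by (simp add: has_contour_integral_integral flip: \<open>contour_integral _ _ = _\<close>)
    qed
    then have "((\<lambda>w. (2 * of_real pi * \<i>) * a w) has_field_derivative
        (of_nat 1 * contour_integral (circlepath 0 (T x)) (\<lambda>u. F u / (u - x) ^ Suc 1))) (at x)"
      by (intro Cauchy_next_derivative_circlepath(2)) (use contF[of "T x"] xT T0 in auto)
    then have "(\<lambda>w. (2 * of_real pi * \<i>) * a w) field_differentiable at x"
      unfolding field_differentiable_def by blast
    then have "(\<lambda>w. inverse (2 * of_real pi * \<i>) * ((2 * of_real pi * \<i>) * a w)) field_differentiable at x"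
      by (rule field_differentiable_mult[OF field_differentiable_const])
    moreover have "(\<lambda>w. inverse (2 * of_real pi * \<i>) * ((2 * of_real pi * \<i>) * a w)) = a"
      by (simp add: fun_eq_iff field_simps)
    ultimately show ?thesis by simp
  qed
  then have "a holomorphic_on ball 0 r2"
    by (auto simp: holomorphic_on_def intro: field_differentiable_at_within)
  moreover have "F z = a z - circ \<rho> (\<lambda>w. F w / (w - z))"
    if z: "r1 < \<rho>" "\<rho> < cmod z" "cmod z < r2" for z \<rho>
  proof -
    \<comment> \<open>The difference quotient is holomorphic on the whole annulus, so its integrals over the circles
      of radius \<open>t\<close> and \<open>\<rho>\<close> agree.\<close>
    define h where "h w = (if w = z then deriv F z else (F w - F z) / (w - z))" for w
    define t where "t = T z"
    have t: "cmod z < t" "r1 < t" "t < r2" using T[of z] z by (auto simp: t_def)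
    have h: "h holomorphic_on annulus r1 r2"
      unfolding h_def by (rule pole_lemma_open[OF F open_annulus])
    have ci: "(\<lambda>w. F w / (w - z)) contour_integrable_on circlepath 0 s"
        "(\<lambda>w. 1 / (w - z)) contour_integrable_on circlepath 0 s"
      if "r1 < s" "s < r2" "s \<noteq> cmod z" for s
      using that r by (auto intro!: contour_integrable_circle continuous_intros contF)
    have split: "circ s h = circ s (\<lambda>w. F w / (w - z)) - F z * circ s (\<lambda>w. 1 / (w - z))"
      if "r1 < s" "s < r2" "s \<noteq> cmod z" for s
    proof -
      have "0 < s" using that r by linarith
      have "circ s h = circ s (\<lambda>w. F w / (w - z) - F z * (1 / (w - z)))"
        by (rule circ_cong) (use that \<open>0 < s\<close> in \<open>auto simp: h_def diff_divide_distrib\<close>)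
      then show ?thesis
        unfolding circ_def using ci[OF that]
        by (simp only: contour_integral_diff contour_integrable_lmul contour_integral_lmul)
          (simp add: diff_divide_distrib)
    qed
    \<comment> \<open>The kernel integrates to one over the outer circle, which surrounds
      \<open>z\<close>, and to zero over the inner circle, which does not.\<close>
    have "circ t (\<lambda>w. 1 / (w - z)) = 1"
      using Cauchy_integral_circlepath_simple[of "\<lambda>_. 1" 0 t z] t
      by (auto simp: circ_def dest: contour_integral_unique)
    moreover have "circ \<rho> (\<lambda>w. 1 / (w - z)) = 0"
    proof -
      have "((\<lambda>w. 1 / (w - z)) has_contour_integral 0) (circlepath 0 \<rho>)"
        by (rule Cauchy_theorem_convex_simple[where S = "ball 0 (cmod z)"])
          (use z r in \<open>auto intro!: holomorphic_intros\<close>)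
      then show ?thesis by (simp add: circ_def contour_integral_unique)
    qed
    moreover have "circ t h = circ \<rho> h" by (rule circ_eq[OF h]) (use z t r in auto)
    ultimately have "circ t (\<lambda>w. F w / (w - z)) - F z = circ \<rho> (\<lambda>w. F w / (w - z))"
      using split[of t] split[of \<rho>] t z by simp
    then show ?thesis using aT[of z t] t by (simp add: algebra_simps)
  qed
  ultimately show ?thesis using that[of a] aT by blast
qed

text \<open>Expand \<open>1 / (w - z)\<close> into the terms \<open>- w ^ n / z ^ Suc n\<close>, a
  geometric series converging uniformly for \<open>cmod w = \<rho>\<close>. On the unit circle the
  factors \<open>1 / z ^ Suc n\<close> have modulus one.\<close>

lemma norm_principal_part_le:
  assumes F: "continuous_on (sphere 0 \<rho>) F" and \<rho>: "0 < \<rho>" "\<rho> < 1" and z: "cmod z = 1"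
  shows "cmod (circ \<rho> (\<lambda>w. F w / (w - z))) \<le> (\<Sum>n. cmod (circ \<rho> (\<lambda>w. F w * w ^ n)))"
proof -
  have z0: "z \<noteq> 0" using z by auto
  obtain K where K: "\<And>w. cmod w = \<rho> \<Longrightarrow> cmod (F w) \<le> K"
    using compact_continuous_image[OF F] by (metis bounded_iff compact_imp_bounded compact_sphere image_eqI mem_sphere_0)
  have Fn: "continuous_on (sphere 0 \<rho>) (\<lambda>w. F w * w ^ n)" for n by (intro continuous_intros F)
  have S: "summable (\<lambda>n. cmod (circ \<rho> (\<lambda>w. F w * w ^ n)))"
  proof (rule summable_comparison_test'[where g = "\<lambda>n. K * \<rho> ^ n * \<rho>" and N = 0])
    show "norm (cmod (circ \<rho> (\<lambda>w. F w * w ^ n))) \<le> K * \<rho> ^ n * \<rho>" for n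
      unfolding real_norm_def abs_norm_cancel
      by (rule norm_circ_le[OF Fn \<rho>(1)]) (use K \<rho> in \<open>simp add: norm_mult norm_power mult_right_mono\<close>)
  qed (use \<rho> in \<open>auto intro!: summable_mult summable_mult2 summable_geometric\<close>)
  have "(\<lambda>n. circ \<rho> (\<lambda>w. (- 1 / z ^ Suc n) * (F w * w ^ n))) sums circ \<rho> (\<lambda>w. \<Sum>n. (- 1 / z ^ Suc n) * (F w * w ^ n))"
  proof (rule circ_sums[where B = "\<lambda>n. K * \<rho> ^ n"])
    show "continuous_on (sphere 0 \<rho>) (\<lambda>w. (- 1 / z ^ Suc n) * (F w * w ^ n))" for n
      by (intro continuous_on_mult continuous_on_const Fn)
    show "cmod ((- 1 / z ^ Suc n) * (F w * w ^ n)) \<le> K * \<rho> ^ n" if "cmod w = \<rho>" for n w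
      using K[OF that] \<rho> that z by (simp add: norm_mult norm_divide norm_power mult_right_mono)
  qed (use \<rho> in \<open>auto intro!: summable_mult summable_geometric\<close>)
  moreover have "circ \<rho> (\<lambda>w. \<Sum>n. (- 1 / z ^ Suc n) * (F w * w ^ n)) = circ \<rho> (\<lambda>w. F w / (w - z))"
  proof (rule circ_cong)
    fix w assume w: "cmod w = \<rho>"
    then have "cmod (w / z) < 1" "w \<noteq> z" using z \<rho> by (auto simp: norm_divide)
    then have "(\<lambda>n. (- F w / z) * (w / z) ^ n) sums ((- F w / z) * (1 / (1 - w / z)))"
      by (intro sums_mult geometric_sums)
    moreover have "(- F w / z) * (1 / (1 - w / z)) = F w / (w - z)"
    proof -
      have "1 - w / z = - ((w - z) / z)" using z0 by (simp add: diff_divide_distrib)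
      then show ?thesis using z0 by simp
    qed
    moreover have "(- F w / z) * (w / z) ^ n = (- 1 / z ^ Suc n) * (F w * w ^ n)" for n
      by (simp add: power_divide)
    ultimately show "(\<Sum>n. (- 1 / z ^ Suc n) * (F w * w ^ n)) = F w / (w - z)"
      by (simp only: sums_iff)
  qed (rule \<rho>)
  ultimately have eq: "circ \<rho> (\<lambda>w. F w / (w - z)) = (\<Sum>n. (- 1 / z ^ Suc n) * circ \<rho> (\<lambda>w. F w * w ^ n))"
    unfolding circ_cmult[OF Fn \<rho>(1)] by (simp only: sums_iff)
  show ?thesis unfolding eq
    by (rule norm_suminf_le[OF _ S]) (use z in \<open>simp add: norm_mult norm_divide norm_power\<close>)
qed

subsection \<open>Continuation across the circle\<close>

text \<open>A connected set with more than one point has no isolated points. This supplies the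
  accumulation point for the identity theorem on pieces of the circle.\<close>

lemma islimpt_sphere_ball:
  fixes q :: complex
  assumes "q \<in> sphere 0 1" "0 < e"
  shows "q islimpt (sphere 0 1 \<inter> ball q e)"
proof -
  have "q islimpt sphere 0 1"
  proof (rule connected_imp_perfect)
    show "sphere (0::complex) 1 \<noteq> {x}" for x
    proof
      assume "sphere (0::complex) 1 = {x}"
      moreover have "1 \<in> sphere (0::complex) 1" "-1 \<in> sphere (0::complex) 1" by auto
      ultimately have "(1::complex) = -1" by (metis singletonD)
      then show False by simp
    qed
  qed (use assms connected_sphere[of "0::complex" 1] in \<open>simp_all add: DIM_complex\<close>)
  then show ?thesis
    using assms(2) unfolding islimpt_def
    by (metis (no_types, lifting) IntI Int_iff centre_in_ball open_Int open_ball)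
qed

text \<open>Local extensions that agree on an arc agree on overlaps by the identity theorem, so they
  define one function near the circle; compactness gives an annulus of uniform width.\<close>

lemma holomorphic_glue_sphere:
  fixes f :: "complex \<Rightarrow> complex"
  assumes loc: "\<And>p. p \<in> sphere 0 1 \<Longrightarrow> \<exists>e>0. \<exists>h. h holomorphic_on ball p e \<and> (\<forall>z \<in> sphere 0 1 \<inter> ball p e. h z = f z)"
  obtains d g where "0 < d" "d < 1" "g holomorphic_on {z. 1 - d < cmod z \<and> cmod z < 1 + d}"
    "\<And>z. z \<in> sphere 0 1 \<Longrightarrow> g z = f z"
proof -
  obtain E H where E: "\<And>p. p \<in> sphere 0 1 \<Longrightarrow> 0 < E p"
    and H: "\<And>p. p \<in> sphere 0 1 \<Longrightarrow> H p holomorphic_on ball p (E p)"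
    and Hf: "\<And>p z. p \<in> sphere 0 1 \<Longrightarrow> z \<in> sphere 0 1 \<inter> ball p (E p) \<Longrightarrow> H p z = f z"
    using loc by metis
  \<comment> \<open>Halving the radii puts the centre of the smaller disc, a point of the circle, into both discs,
    so that the circle accumulates inside their intersection.\<close>
  have agree1: "H p z = H q z"
    if p: "p \<in> sphere 0 1" and q: "q \<in> sphere 0 1" and z: "dist p z < E p / 2" "dist q z < E q / 2"
      and le: "E q \<le> E p" for p q z
  proof -
    define W where "W = ball p (E p) \<inter> ball q (E q)"
    have "dist p q < E p"
      using dist_triangle[of p q z] z le by (simp add: dist_commute)
    then have qW: "q \<in> W" using E[OF q] by (simp add: W_def)
    have "open W" unfolding W_def by (intro open_Int open_ball)
    with qW obtain e where e: "0 < e" "ball q e \<subseteq> W" by (meson open_contains_ball)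
    have "H p z - H q z = 0"
    proof (rule analytic_continuation[where f = "\<lambda>z. H p z - H q z" and S = W and U = "sphere 0 1 \<inter> ball q e" and \<xi> = q])
      show "(\<lambda>z. H p z - H q z) holomorphic_on W"
        unfolding W_def by (intro holomorphic_on_diff holomorphic_on_subset[OF H[OF p]] holomorphic_on_subset[OF H[OF q]]) auto
      show "connected W" unfolding W_def by (intro convex_connected convex_Int convex_ball)
      show "q islimpt sphere 0 1 \<inter> ball q e" by (rule islimpt_sphere_ball[OF q e(1)])
      show "z \<in> W" using z E[OF p] E[OF q] by (simp add: W_def)
      show "H p w - H q w = 0" if "w \<in> sphere 0 1 \<inter> ball q e" for w
      proof -
        have "w \<in> W" using that e(2) by blast
        then show ?thesis using Hf[OF p, of w] Hf[OF q, of w] that by (simp add: W_def)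
      qed
    qed (use \<open>open W\<close> qW e in auto)
    then show ?thesis by simp
  qed
  have agree: "H p z = H q z"
    if "p \<in> sphere 0 1" "q \<in> sphere 0 1" "dist p z < E p / 2" "dist q z < E q / 2" for p q z
    using agree1[OF that] agree1[OF that(2,1,4,3)] by (cases "E q \<le> E p") auto
  define U where "U = (\<Union>p\<in>sphere 0 1. ball p (E p / 2))"
  define g where "g z = H (SOME p. p \<in> sphere 0 1 \<and> dist p z < E p / 2) z" for z
  have gH: "g z = H p z" if "p \<in> sphere 0 1" "dist p z < E p / 2" for p z
  proof -
    have "\<exists>p. p \<in> sphere 0 1 \<and> dist p z < E p / 2" using that by blast
    from someI_ex[OF this] show ?thesis unfolding g_def using that by (intro agree) auto
  qed
  have "g holomorphic_on U"
    unfolding U_def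
  proof (rule holomorphic_on_UN_open)
    fix p :: complex assume p: "p \<in> sphere 0 1"
    have "H p holomorphic_on ball p (E p / 2)"
      by (rule holomorphic_on_subset[OF H[OF p]]) (use E[OF p] in auto)
    then show "g holomorphic_on ball p (E p / 2)"
      by (rule holomorphic_transform) (use gH[OF p] in auto)
  qed auto
  moreover have "sphere 0 1 \<subseteq> U" unfolding U_def using E by force
  moreover have "open U" by (auto simp: U_def)
  ultimately obtain e where e: "0 < e" "(\<Union>x\<in>sphere (0::complex) 1. ball x e) \<subseteq> U"
    using compact_subset_open_imp_ball_epsilon_subset[of "sphere (0::complex) 1" U] by auto
  \<comment> \<open>The cap \<open>1/2\<close> keeps the annulus away from zero. The radial
    projection \<open>sgn z\<close> then lies on the circle, at distance
    \<open>\<bar>1 - cmod z\<bar>\<close> from \<open>z\<close>.\<close>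
  define d where "d = min e (1/2)"
  have "{z. 1 - d < cmod z \<and> cmod z < 1 + d} \<subseteq> U"
  proof
    fix z :: complex assume z: "z \<in> {z. 1 - d < cmod z \<and> cmod z < 1 + d}"
    then have "z \<noteq> 0" by (auto simp: d_def)
    have "sgn z - z = of_real (1 - cmod z) * sgn z"
      by (simp add: algebra_simps) (simp add: sgn_div_norm scaleR_conv_of_real \<open>z \<noteq> 0\<close>)
    then have "cmod (sgn z - z) = \<bar>1 - cmod z\<bar>"
      using \<open>z \<noteq> 0\<close> by (simp only: norm_mult norm_of_real norm_sgn) simp
    also have "\<dots> < e" using z by (auto simp: d_def)
    finally have "z \<in> ball (sgn z) e" by (simp add: dist_norm)
    moreover have "sgn z \<in> sphere 0 1" using \<open>z \<noteq> 0\<close> by (simp add: norm_sgn)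
    ultimately show "z \<in> U" using e(2) by blast
  qed
  with \<open>g holomorphic_on U\<close> have "g holomorphic_on {z. 1 - d < cmod z \<and> cmod z < 1 + d}"
    by (rule holomorphic_on_subset)
  moreover have "g z = f z" if "z \<in> sphere 0 1" for z
    using gH[OF that, of z] Hf[OF that, of z] E[OF that] that by auto
  ultimately show ?thesis using that[of d g] e(1) by (auto simp: d_def)
qed

text \<open>Putting the complex quantity \<open>- \<i> * Ln (z / p)\<close> in place of
  \<open>t - t0\<close> in the power series gives the extension; dividing by \<open>p\<close> moves
  the centre to 1, away from the branch cut of \<open>Ln\<close>.\<close>

lemma real_analytic_local_extension:
  assumes ran: "real_analytic (\<lambda>\<theta>. f (cis \<theta>))" and p: "p \<in> sphere 0 1"
  shows "\<exists>e>0. \<exists>h. h holomorphic_on ball p e \<and> (\<forall>z \<in> sphere 0 1 \<inter> ball p e. h z = f z)"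
proof -
  have p0: "p \<noteq> 0" using p by auto
  define t0 where "t0 = Arg p"
  have pt: "cis t0 = p" using p p0 by (simp add: t0_def cis_Arg sgn_div_norm)
  obtain r c where r: "0 < r"
    and sums: "\<And>t. \<bar>t - t0\<bar> < r \<Longrightarrow> (\<lambda>n. c n * of_real ((t - t0) ^ n)) sums f (cis t)"
    using ran unfolding real_analytic_def by blast
  define G where "G u = (\<Sum>n. c n * u ^ n)" for u
  have "G holomorphic_on ball 0 r"
  proof (rule power_series_holomorphic[where a = c])
    fix w :: complex assume "w \<in> ball 0 r"
    then have w: "cmod w < r" by simp
    then obtain s where s: "cmod w < s" "s < r" using dense by blast
    then have "0 < s" using norm_ge_zero[of w] by linarith
    \<comment> \<open>Convergence at the single real point \<open>s\<close> forces convergence in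
      the whole complex disc of radius \<open>s\<close>.\<close>
    have "summable (\<lambda>n. c n * of_real s ^ n)"
      using sums[of "t0 + s"] s \<open>0 < s\<close> by (auto simp: sums_iff)
    then have "summable (\<lambda>n. c n * w ^ n)"
      by (rule powser_inside) (use s \<open>0 < s\<close> in auto)
    then show "(\<lambda>n. c n * (w - 0) ^ n) sums G w" by (simp add: G_def summable_sums)
  qed
  have "isCont (\<lambda>w. cmod (Ln w)) 1" by (intro continuous_intros) auto
  then obtain e where e: "0 < e" "\<And>w. dist w 1 < e \<Longrightarrow> dist (cmod (Ln w)) (cmod (Ln 1)) < r"
    using r unfolding continuous_at_eps_delta by blast
  \<comment> \<open>Distance less than one from the point 1 keeps \<open>z / p\<close> off the
    nonpositive real axis.\<close>
  define e' where "e' = min e 1"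
  define h where "h z = G (- \<i> * Ln (z / p))" for z
  have near: "dist (z / p) 1 < e'" if "z \<in> ball p e'" for z
  proof -
    have "dist (z / p) 1 = cmod ((z - p) / p)" using p0 by (simp add: dist_norm divide_simps)
    also have "\<dots> = dist p z" using p by (simp add: norm_divide dist_norm norm_minus_commute)
    finally show ?thesis using that by simp
  qed
  have Lnr: "cmod (Ln (z / p)) < r" if "z \<in> ball p e'" for z
    using e(2)[of "z / p"] near[OF that] by (simp add: e'_def)
  have "h holomorphic_on ball p e'"
    unfolding h_def
  proof (rule holomorphic_on_compose_gen[unfolded o_def, where g = G and t = "ball 0 r"])
    have "z / p \<notin> \<real>\<^sub>\<le>\<^sub>0" if "z \<in> ball p e'" for z
    proof
      assume "z / p \<in> \<real>\<^sub>\<le>\<^sub>0"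
      then have "Re (z / p - 1) \<le> -1" by (auto simp: complex_nonpos_Reals_iff)
      then have "1 \<le> cmod (z / p - 1)" using abs_Re_le_cmod[of "z / p - 1"] by linarith
      then show False using near[OF that] by (simp add: dist_norm e'_def)
    qed
    then show "(\<lambda>z. - \<i> * Ln (z / p)) holomorphic_on ball p e'"
      using p0 by (intro holomorphic_intros) auto
    show "(\<lambda>z. - \<i> * Ln (z / p)) ` ball p e' \<subseteq> ball 0 r"
      using Lnr by (auto simp: norm_mult)
  qed fact
  moreover have "h z = f z" if z: "z \<in> sphere 0 1 \<inter> ball p e'" for z
  proof -
    define u where "u = Arg (z / p)"
    have zp: "cmod (z / p) = 1" "z / p \<noteq> 0" using z p by (auto simp: norm_divide)
    have Ln: "Ln (z / p) = \<i> * of_real u"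
      using zp Arg_def[of "z / p"] by (intro complex_eqI) (auto simp: u_def Arg_def Re_Ln)
    then have "\<bar>u\<bar> < r" using Lnr[of z] z by (simp add: norm_mult)
    have "cis u = z / p" using zp by (simp add: u_def cis_Arg sgn_div_norm)
    then have "z = cis (t0 + u)" using p0 by (simp add: cis_mult[symmetric] pt)
    moreover have "(\<lambda>n. c n * of_real u ^ n) sums f (cis (t0 + u))"
      using sums[of "t0 + u"] \<open>\<bar>u\<bar> < r\<close> by simp
    moreover have "- \<i> * Ln (z / p) = of_real u" by (simp add: Ln)
    ultimately show ?thesis
      by (simp only: h_def G_def sums_iff)
  qed
  ultimately show ?thesis using e(1) by (intro exI[of _ e'] conjI exI[of _ h]) (auto simp: e'_def)
qed

subsection \<open>Bounded evaluations\<close>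

lemma power_series_geometric_coeffs:
  fixes b :: "nat \<Rightarrow> complex"
  assumes b: "\<And>j. cmod (b j) \<le> B * \<rho> ^ j" and \<rho>: "0 < \<rho>" and z: "cmod z < 1 / \<rho>"
  shows "summable (\<lambda>j. b j * z ^ j)"
proof (rule summable_comparison_test'[where g = "\<lambda>j. B * (\<rho> * cmod z) ^ j" and N = 0])
  show "norm (b j * z ^ j) \<le> B * (\<rho> * cmod z) ^ j" for j
    using mult_right_mono[OF b[of j], of "cmod z ^ j"] by (simp add: norm_mult norm_power power_mult_distrib mult_ac)
  show "summable (\<lambda>j. B * (\<rho> * cmod z) ^ j)"
    using z \<rho> by (intro summable_mult summable_geometric) (simp add: field_simps)
qed

lemma power_series_geometric_holomorphic:
  fixes b :: "nat \<Rightarrow> complex"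
  assumes b: "\<And>j. cmod (b j) \<le> B * \<rho> ^ j" and \<rho>: "0 < \<rho>"
  shows "(\<lambda>z. \<Sum>j. b j * z ^ j) holomorphic_on ball 0 (1 / \<rho>)"
  by (rule power_series_holomorphic[where a = b])
    (use power_series_geometric_coeffs[OF assms] in \<open>auto intro: summable_sums\<close>)

text \<open>The circle of radius \<open>\<rho>\<close> carries the integrals for moments and
  principal parts. As \<open>\<rho> < 1\<close>, power series with coefficients bounded by
  \<open>B * \<rho> ^ j\<close> converge past the closed unit disc, and the moments decay at the
  same rate, as \<open>hankel_duality\<close> requires.\<close>

locale annulus_extension =
  fixes \<phi> \<Phi> :: "complex \<Rightarrow> complex" and r1 r2 \<rho> :: real
  assumes cont: "continuous_on (cball 0 1) \<phi>"
    and hol: "\<Phi> holomorphic_on annulus r1 r2"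
    and radii: "0 \<le> r1" "r1 < \<rho>" "\<rho> < 1" "1 < r2"
    and boundary: "\<And>z. z \<in> sphere 0 1 \<Longrightarrow> \<Phi> z = \<phi> z"
begin

text \<open>The Laurent coefficient of \<open>\<Phi>\<close> at the power \<open>-(n+1)\<close>; the
  numbers \<open>moment (n + j)\<close> are the entries of the Hankel matrix.\<close>

definition moment :: "nat \<Rightarrow> complex" where
  "moment n = circ \<rho> (\<lambda>w. \<Phi> w * w ^ n)"

lemma rho_pos: "0 < \<rho>"
  using radii by linarith

lemma rho_less_inverse: "\<rho> < 1 / \<rho>"
  by (rule less_trans[OF radii(3)]) (use radii(3) rho_pos in simp)

lemma continuous_on_circle: "r1 < t \<Longrightarrow> t < r2 \<Longrightarrow> continuous_on (sphere 0 t) \<Phi>"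
  by (rule holomorphic_on_imp_continuous_on[OF holomorphic_on_subset[OF hol]]) auto

lemma bounded_on_circle:
  assumes "r1 < t" "t < r2"
  obtains K where "0 \<le> K" "\<And>w. cmod w = t \<Longrightarrow> cmod (\<Phi> w) \<le> K"
proof -
  obtain K where K: "\<And>w. cmod w = t \<Longrightarrow> cmod (\<Phi> w) \<le> K"
    using compact_continuous_image[OF continuous_on_circle[OF assms]]
    by (metis bounded_iff compact_imp_bounded compact_sphere image_eqI mem_sphere_0)
  have "cmod (of_real t) = t" using radii assms by simp
  then have "0 \<le> K" using K[of "of_real t"] norm_ge_zero order_trans by blast
  with K show ?thesis using that by blast
qed

lemma moment_bound: obtains C where "\<And>n. cmod (moment n) \<le> C * \<rho> ^ n"
proof -
  obtain K where K: "\<And>w. cmod w = \<rho> \<Longrightarrow> cmod (\<Phi> w) \<le> K"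
    using bounded_on_circle[of \<rho>] radii by auto
  have "cmod (moment n) \<le> (K * \<rho> ^ n) * \<rho>" for n
    unfolding moment_def
    by (rule norm_circ_le)
      (use K rho_pos radii in \<open>auto simp: norm_mult norm_power intro!: mult_right_mono continuous_intros continuous_on_circle\<close>)
  then show ?thesis using that[of "K * \<rho>"] by (simp add: mult_ac)
qed

text \<open>Termwise integration: the Hankel matrix applied to \<open>b\<close> yields the negative
  Laurent coefficients of the product of the power series with \<open>\<Phi>\<close>.\<close>

lemma moment_power_series:
  assumes b: "\<And>j. cmod (b j) \<le> B * \<rho> ^ j"
  shows "circ \<rho> (\<lambda>w. (\<Sum>j. b j * w ^ j) * \<Phi> w * w ^ n) = (\<Sum>j. b j * moment (n + j))"
proof -
  obtain K where K: "0 \<le> K" "\<And>w. cmod w = \<rho> \<Longrightarrow> cmod (\<Phi> w) \<le> K"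
    using bounded_on_circle[of \<rho>] radii by auto
  have c: "continuous_on (sphere 0 \<rho>) (\<lambda>w. \<Phi> w * w ^ m)" for m
    using radii by (intro continuous_intros continuous_on_circle) auto
  have B0: "0 \<le> B" using order_trans[OF norm_ge_zero b[of 0]] by simp
  have "(\<lambda>j. circ \<rho> (\<lambda>w. b j * (\<Phi> w * w ^ (n + j)))) sums circ \<rho> (\<lambda>w. \<Sum>j. b j * (\<Phi> w * w ^ (n + j)))"
  proof (rule circ_sums[where B = "\<lambda>j. B * K * \<rho> ^ j"])
    fix j w assume w: "cmod w = \<rho>"
    have "cmod (b j * (\<Phi> w * w ^ (n + j))) \<le> (B * \<rho> ^ j) * (K * 1)"
      unfolding norm_mult norm_power w
      using b[of j] K(2)[OF w] K(1) B0 radii rho_pos by (intro mult_mono power_le_one) auto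
    then show "cmod (b j * (\<Phi> w * w ^ (n + j))) \<le> B * K * \<rho> ^ j" by (simp add: mult_ac)
  next
    show "continuous_on (sphere 0 \<rho>) (\<lambda>w. b j * (\<Phi> w * w ^ (n + j)))" for j
      by (rule continuous_on_mult[OF continuous_on_const c])
  qed (use radii rho_pos in \<open>auto intro!: summable_mult summable_geometric\<close>)
  moreover have "circ \<rho> (\<lambda>w. \<Sum>j. b j * (\<Phi> w * w ^ (n + j))) = circ \<rho> (\<lambda>w. (\<Sum>j. b j * w ^ j) * \<Phi> w * w ^ n)"
  proof (rule circ_cong)
    fix w assume w: "cmod w = \<rho>"
    then have "cmod w < 1 / \<rho>" by (simp add: rho_less_inverse)
    then have "(\<Sum>j. b j * w ^ j) * (\<Phi> w * w ^ n) = (\<Sum>j. (b j * w ^ j) * (\<Phi> w * w ^ n))"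
      by (intro suminf_mult2 power_series_geometric_coeffs[OF b rho_pos])
    then show "(\<Sum>j. b j * (\<Phi> w * w ^ (n + j))) = (\<Sum>j. b j * w ^ j) * \<Phi> w * w ^ n"
      by (simp add: power_add mult_ac)
  qed (rule rho_pos)
  ultimately show ?thesis
    unfolding circ_cmult[OF c rho_pos] moment_def by (simp only: sums_iff)
qed

text \<open>Subtract from \<open>\<beta> \<phi>\<close> the analytic part \<open>a\<close> of
  \<open>\<beta> \<Phi>\<close>. The difference lies in the module, and on the unit circle it is a
  principal part, which \<open>norm_principal_part_le\<close> controls by moments.\<close>

lemma module_estimate:
  assumes bound: "\<And>f. f \<in> module_M \<phi> \<Longrightarrow> cmod (f x) \<le> M * (SUP w\<in>sphere 0 1. cmod (f w))"
    and M: "0 \<le> M" and x: "cmod x < t" and t: "r1 < t" "t < 1"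
    and b: "\<And>j. cmod (b j) \<le> B * \<rho> ^ j"
  shows "cmod ((\<Sum>j. b j * x ^ j) * \<phi> x - circ t (\<lambda>w. (\<Sum>j. b j * w ^ j) * \<Phi> w / (w - x)))
    \<le> M * (\<Sum>n. cmod (\<Sum>j. b j * moment (n + j)))"
proof -
  define \<beta> where "\<beta> z = (\<Sum>j. b j * z ^ j)" for z
  define F where "F z = \<beta> z * \<Phi> z" for z
  \<comment> \<open>Both \<open>\<beta>\<close> and \<open>\<Phi>\<close> are holomorphic for moduli
    between \<open>r1\<close> and \<open>R\<close>, and \<open>R > 1\<close> puts \<open>a\<close>
    into the disk algebra.\<close>
  define R where "R = min r2 (1 / \<rho>)"
  have R: "1 < R" "R \<le> r2" "R \<le> 1 / \<rho>" using radii rho_pos by (auto simp: R_def)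
  have \<beta>: "\<beta> holomorphic_on ball 0 (1 / \<rho>)"
    unfolding \<beta>_def by (rule power_series_geometric_holomorphic[OF b rho_pos])
  have F: "F holomorphic_on annulus r1 R"
    unfolding F_def
    by (intro holomorphic_on_mult holomorphic_on_subset[OF \<beta>] holomorphic_on_subset[OF hol]) (use R in auto)
  obtain a where a: "a holomorphic_on ball 0 R"
    and ax: "\<And>x t. cmod x < t \<Longrightarrow> r1 < t \<Longrightarrow> t < R \<Longrightarrow> a x = circ t (\<lambda>w. F w / (w - x))"
    and aF: "\<And>z \<rho>. r1 < \<rho> \<Longrightarrow> \<rho> < cmod z \<Longrightarrow> cmod z < R \<Longrightarrow> F z = a z - circ \<rho> (\<lambda>w. F w / (w - z))"
    using annulus_split[OF F] radii R by auto
  define f where "f z = - a z + \<beta> z * \<phi> z" for z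
  have disk: "g \<in> disk_algebra" if "g holomorphic_on ball 0 R" for g
    unfolding disk_algebra_def using R
    by (auto intro!: holomorphic_on_subset[OF that] holomorphic_on_imp_continuous_on)
  have "f \<in> module_M \<phi>"
    unfolding module_M_def f_def
    by (intro CollectI exI[of _ "\<lambda>z. - a z"] exI[of _ \<beta>] conjI refl disk holomorphic_on_minus a
        holomorphic_on_subset[OF \<beta>]) (use R in auto)
  from bound[OF this] have fx: "cmod (f x) \<le> M * (SUP w\<in>sphere 0 1. cmod (f w))" .
  have "cmod (f w) \<le> (\<Sum>n. cmod (\<Sum>j. b j * moment (n + j)))" if w: "w \<in> sphere 0 1" for w
  proof -
    have "f w = F w - a w" using boundary[OF w] by (simp add: f_def F_def)
    also have "\<dots> = - circ \<rho> (\<lambda>v. F v / (v - w))" using aF[of \<rho> w] radii R w by simp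
    finally have "cmod (f w) = cmod (circ \<rho> (\<lambda>v. F v / (v - w)))" by simp
    also have "\<dots> \<le> (\<Sum>n. cmod (circ \<rho> (\<lambda>v. F v * v ^ n)))"
      by (rule norm_principal_part_le[OF holomorphic_on_imp_continuous_on[OF holomorphic_on_subset[OF F]]])
        (use radii rho_pos R w in auto)
    also have "\<dots> = (\<Sum>n. cmod (\<Sum>j. b j * moment (n + j)))"
      using moment_power_series[OF b] by (simp add: F_def \<beta>_def)
    finally show ?thesis .
  qed
  then have "(SUP w\<in>sphere 0 1. cmod (f w)) \<le> (\<Sum>n. cmod (\<Sum>j. b j * moment (n + j)))"
    by (intro cSUP_least) auto
  then have "cmod (f x) \<le> M * (\<Sum>n. cmod (\<Sum>j. b j * moment (n + j)))"
    using fx mult_left_mono[OF _ M] by (rule_tac order_trans) blast+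
  moreover have "f x = \<beta> x * \<phi> x - circ t (\<lambda>w. F w / (w - x))"
    using ax[of x t] x t R by (simp add: f_def)
  ultimately show ?thesis by (simp add: F_def \<beta>_def)
qed

text \<open>Apply \<open>module_estimate\<close> at 0 to the series multiplied by \<open>z\<close>.
  The value of \<open>\<phi>\<close> drops out, the factor \<open>z\<close> cancels the Cauchy
  kernel so that the analytic part at 0 is the pairing of \<open>b\<close> with the first row, and
  every row index on the right rises by one.\<close>

lemma moment_estimate:
  assumes bound: "\<And>f. f \<in> module_M \<phi> \<Longrightarrow> cmod (f 0) \<le> M * (SUP w\<in>sphere 0 1. cmod (f w))"
    and M: "0 \<le> M" and b: "\<And>j. cmod (b j) \<le> B * \<rho> ^ j"
  shows "cmod (\<Sum>j. b j * moment j) \<le> M * (\<Sum>n. cmod (\<Sum>j. b j * moment (Suc n + j)))"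
proof -
  define d where "d j = (case j of 0 \<Rightarrow> 0 | Suc i \<Rightarrow> b i)" for j
  have d0: "d 0 = 0" and dS: "\<And>i. d (Suc i) = b i" by (auto simp: d_def)
  have B0: "0 \<le> B" using order_trans[OF norm_ge_zero b[of 0]] by simp
  have db: "cmod (d j) \<le> (B / \<rho>) * \<rho> ^ j" for j
    using b B0 rho_pos by (cases j) (auto simp: d_def)
  have shift: "(\<Sum>j. d j * y j) = (\<Sum>j. b j * y (Suc j))" for y :: "nat \<Rightarrow> complex"
  proof (cases "summable (\<lambda>j. d j * y j)")
    case True
    from suminf_split_head[OF this] show ?thesis by (simp add: d0 dS)
  next
    \<comment> \<open>Both series diverge together, and \<open>suminf\<close> then gives them the
      same unspecified value.\<close>
    case False
    then have "\<not> summable (\<lambda>j. b j * y (Suc j))"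
      using summable_Suc_iff[of "\<lambda>j. d j * y j"] by (simp add: dS)
    with False show ?thesis by (simp add: suminf_def summable_def)
  qed
  have "circ \<rho> (\<lambda>w. (\<Sum>j. d j * w ^ j) * \<Phi> w / (w - 0)) = circ \<rho> (\<lambda>w. (\<Sum>j. b j * w ^ j) * \<Phi> w * w ^ 0)"
  proof (rule circ_cong)
    fix w assume w: "cmod w = \<rho>"
    then have "cmod w < 1 / \<rho>" by (simp add: rho_less_inverse)
    then have "(\<Sum>j. b j * w ^ j * w) = (\<Sum>j. b j * w ^ j) * w"
      by (intro suminf_mult2[symmetric] power_series_geometric_coeffs[OF b rho_pos])
    then have "(\<Sum>j. d j * w ^ j) = (\<Sum>j. b j * w ^ j) * w"
      by (simp add: shift mult_ac)
    moreover have "w \<noteq> 0" using w rho_pos by auto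
    ultimately show "(\<Sum>j. d j * w ^ j) * \<Phi> w / (w - 0) = (\<Sum>j. b j * w ^ j) * \<Phi> w * w ^ 0" by simp
  qed (rule rho_pos)
  also have "\<dots> = (\<Sum>j. b j * moment j)" using moment_power_series[OF b, of 0] by simp
  finally have *: "circ \<rho> (\<lambda>w. (\<Sum>j. d j * w ^ j) * \<Phi> w / (w - 0)) = (\<Sum>j. b j * moment j)" .
  have "(\<Sum>j. d j * 0 ^ j) = 0" using shift[of "power 0"] by simp
  then show ?thesis
    using module_estimate[OF bound M _ radii(2,3) db] rho_pos unfolding * by (simp add: shift)
qed

text \<open>Since \<open>\<kappa>\<close> is merely bounded, \<open>module_estimate\<close> is
  applied to its truncations \<open>p m\<close>. The relation \<open>k(2)\<close> turns their
  moments into tails of convergent series, of size \<open>\<rho> ^ m\<close>, so the two sides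
  differ by a quantity tending to zero.\<close>

lemma annihilated_multiplier:
  assumes k: "\<And>n. cmod (k n) \<le> N" "\<And>j. (\<lambda>n. k n * moment (Suc n + j)) sums moment j"
    and bound: "\<And>f. f \<in> module_M \<phi> \<Longrightarrow> cmod (f x) \<le> M * (SUP w\<in>sphere 0 1. cmod (f w))"
    and M: "0 \<le> M" and x: "cmod x < t" and t: "r1 < t" "t < 1"
    and \<kappa>: "\<And>j. \<kappa> j = (case j of 0 \<Rightarrow> 1 | Suc i \<Rightarrow> - k i)"
  shows "(\<Sum>j. \<kappa> j * x ^ j) * \<phi> x = circ t (\<lambda>w. (\<Sum>j. \<kappa> j * w ^ j) * \<Phi> w / (w - x))"
proof -
  obtain C where C: "\<And>n. cmod (moment n) \<le> C * \<rho> ^ n" using moment_bound by blast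
  have C0: "0 \<le> C" using order_trans[OF norm_ge_zero C[of 0]] by simp
  have N0: "0 \<le> N" using order_trans[OF norm_ge_zero k(1)[of 0]] .
  define N1 where "N1 = max N 1"
  have \<kappa>b: "cmod (\<kappa> j) \<le> N1" for j
    using k(1) by (auto simp: \<kappa> N1_def max_def split: nat.split) (meson le_cases order_trans)+
  have t0: "0 < t" using x norm_ge_zero[of x] by linarith
  define p where "p m j = (if j < Suc m then \<kappa> j else 0)" for m j :: nat
  have psum: "(\<Sum>j. p m j * y j) = (\<Sum>j<Suc m. \<kappa> j * y j)" for m and y :: "nat \<Rightarrow> complex"
    by (subst suminf_finite[of "{..<Suc m}"]) (auto simp: p_def)
  \<comment> \<open>The constant grows with \<open>m\<close>, which \<open>module_estimate\<close>
    tolerates because its right side involves the coefficients only through the moments.\<close>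
  have pb: "cmod (p m j) \<le> (N1 / \<rho> ^ m) * \<rho> ^ j" for m j
  proof (cases "j \<le> m")
    case True
    then have "\<rho> ^ m \<le> \<rho> ^ j" using radii rho_pos by (intro power_decreasing) auto
    then have "N1 * 1 \<le> N1 * (\<rho> ^ j / \<rho> ^ m)"
      using rho_pos by (intro mult_left_mono) (auto simp: N1_def)
    then show ?thesis using \<kappa>b[of j] True by (simp add: p_def)
  next
    case False
    then show ?thesis using rho_pos by (simp add: p_def N1_def)
  qed
  \<comment> \<open>The entry \<open>\<kappa> 0 = 1\<close> contributes \<open>moment n\<close>,
    from which the first \<open>m\<close> terms of its own expansion are subtracted. The bound also
    decays in \<open>n\<close>, so the sum over all rows still carries the factor
    \<open>\<rho> ^ m\<close>.\<close>
  have tail: "cmod (\<Sum>j. p m j * moment (n + j)) \<le> (N * C / (1 - \<rho>) * \<rho> ^ m) * \<rho> ^ n" for m n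
  proof -
    have "(\<Sum>j. p m j * moment (n + j)) = moment n - (\<Sum>i<m. k i * moment (Suc i + n))"
      by (simp add: psum sum.lessThan_Suc_shift \<kappa> sum_negf add.commute del: sum.lessThan_Suc)
    also have "\<dots> = (\<Sum>i. k (i + m) * moment (Suc (i + m) + n))"
      using suminf_minus_initial_segment[OF sums_summable[OF k(2)[of n]], of m] k(2)[of n]
      by (simp add: sums_iff)
    finally have eq: "(\<Sum>j. p m j * moment (n + j)) = (\<Sum>i. k (i + m) * moment (Suc (i + m) + n))" .
    have "cmod (\<Sum>i. k (i + m) * moment (Suc (i + m) + n)) \<le> (\<Sum>i. (N * C * \<rho> ^ m * \<rho> ^ n) * \<rho> ^ i)"
    proof (rule norm_suminf_le)
      fix i
      have "cmod (k (i + m) * moment (Suc (i + m) + n)) \<le> N * (C * \<rho> ^ (Suc (i + m) + n))"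
        unfolding norm_mult by (intro mult_mono k(1) C N0 norm_ge_zero)
      also have "\<dots> \<le> N * (C * \<rho> ^ (i + m + n))"
        using N0 C0 radii rho_pos by (intro mult_left_mono power_decreasing) auto
      finally show "cmod (k (i + m) * moment (Suc (i + m) + n)) \<le> (N * C * \<rho> ^ m * \<rho> ^ n) * \<rho> ^ i"
        by (simp add: power_add mult_ac)
    qed (use radii rho_pos in \<open>auto intro!: summable_mult summable_geometric\<close>)
    also have "\<dots> = (N * C / (1 - \<rho>) * \<rho> ^ m) * \<rho> ^ n"
      using radii rho_pos by (subst suminf_mult) (auto simp: suminf_geometric summable_geometric)
    finally show ?thesis unfolding eq .
  qed
  define A where "A m = (\<Sum>j<Suc m. \<kappa> j * x ^ j) * \<phi> x
    - circ t (\<lambda>w. \<Sum>j<Suc m. \<kappa> j * w ^ j * (\<Phi> w / (w - x)))" for m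
  have A: "cmod (A m) \<le> M * (N * C / (1 - \<rho>) / (1 - \<rho>)) * \<rho> ^ m" for m
  proof -
    have "(\<Sum>n. cmod (\<Sum>j. p m j * moment (n + j))) \<le> (\<Sum>n. (N * C / (1 - \<rho>) * \<rho> ^ m) * \<rho> ^ n)"
    proof (rule suminf_le[OF tail])
      show S: "summable (\<lambda>n. (N * C / (1 - \<rho>) * \<rho> ^ m) * \<rho> ^ n)"
        using radii rho_pos by (auto intro!: summable_mult summable_geometric)
      show "summable (\<lambda>n. cmod (\<Sum>j. p m j * moment (n + j)))"
        by (rule summable_comparison_test'[OF S, of 0]) (use tail in simp)
    qed
    also have "(\<Sum>n. (N * C / (1 - \<rho>) * \<rho> ^ m) * \<rho> ^ n) = (N * C / (1 - \<rho>) * \<rho> ^ m) / (1 - \<rho>)"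
      using radii rho_pos by (subst suminf_mult) (auto simp: suminf_geometric summable_geometric)
    finally have "M * (\<Sum>n. cmod (\<Sum>j. p m j * moment (n + j))) \<le> M * ((N * C / (1 - \<rho>) * \<rho> ^ m) / (1 - \<rho>))"
      by (rule mult_left_mono) (rule M)
    moreover have "cmod (A m) \<le> M * (\<Sum>n. cmod (\<Sum>j. p m j * moment (n + j)))"
      using module_estimate[OF bound M x t pb[of m]]
      unfolding psum A_def by (simp add: sum_distrib_right sum_divide_distrib del: sum.lessThan_Suc)
    ultimately show ?thesis by (simp add: mult_ac)
  qed
  have "(\<lambda>m. M * (N * C / (1 - \<rho>) / (1 - \<rho>)) * \<rho> ^ m) \<longlonglongrightarrow> 0"
    using radii rho_pos by (intro tendsto_mult_right_zero LIMSEQ_power_zero) simp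
  then have A0: "A \<longlonglongrightarrow> 0"
    by (rule Lim_null_comparison[rotated]) (rule always_eventually, rule allI, rule A)
  have sm: "summable (\<lambda>j. \<kappa> j * w ^ j)" if "cmod w < 1" for w
    using power_series_geometric_coeffs[of \<kappa> N1 1 w] \<kappa>b that by simp
  obtain K where K: "0 \<le> K" "\<And>w. cmod w = t \<Longrightarrow> cmod (\<Phi> w) \<le> K"
    using bounded_on_circle[of t] t radii by auto
  \<comment> \<open>On the circle of radius \<open>t < 1\<close> bounded coefficients give geometric
    convergence, while \<open>w\<close> keeps distance at least \<open>t - cmod x\<close> from
    \<open>x\<close>.\<close>
  have lim: "(\<lambda>m. circ t (\<lambda>w. \<Sum>j<m. \<kappa> j * w ^ j * (\<Phi> w / (w - x))))
      \<longlonglongrightarrow> circ t (\<lambda>w. \<Sum>j. \<kappa> j * w ^ j * (\<Phi> w / (w - x)))"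
  proof (rule circ_suminf_LIMSEQ[OF t0, where B = "\<lambda>j. N1 * (K / (t - cmod x)) * t ^ j"])
    show "continuous_on (sphere 0 t) (\<lambda>w. \<kappa> j * w ^ j * (\<Phi> w / (w - x)))" for j
      using x t radii by (auto intro!: continuous_intros continuous_on_circle)
    show "summable (\<lambda>j. N1 * (K / (t - cmod x)) * t ^ j)"
      using t t0 by (intro summable_mult summable_geometric) auto
    fix j w assume w: "cmod w = t"
    have "t - cmod x \<le> cmod (w - x)" using norm_triangle_ineq2[of w x] w by simp
    then have "cmod (\<Phi> w / (w - x)) \<le> K / (t - cmod x)"
      unfolding norm_divide using K x w by (intro frac_le) auto
    then have "cmod (\<kappa> j * w ^ j * (\<Phi> w / (w - x))) \<le> (N1 * t ^ j) * (K / (t - cmod x))"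
      unfolding norm_mult[of "\<kappa> j * w ^ j"] norm_mult[of "\<kappa> j"] norm_power w
      using \<kappa>b[of j] t0 by (intro mult_mono) (auto simp: N1_def)
    then show "cmod (\<kappa> j * w ^ j * (\<Phi> w / (w - x))) \<le> N1 * (K / (t - cmod x)) * t ^ j"
      by (simp add: mult_ac)
  qed
  have "circ t (\<lambda>w. \<Sum>j. \<kappa> j * w ^ j * (\<Phi> w / (w - x))) = circ t (\<lambda>w. (\<Sum>j. \<kappa> j * w ^ j) * \<Phi> w / (w - x))"
  proof (rule circ_cong[OF _ t0])
    fix w assume "cmod w = t"
    then have "cmod w < 1" using t by simp
    from suminf_mult2[OF sm[OF this], of "\<Phi> w / (w - x)"]
    show "(\<Sum>j. \<kappa> j * w ^ j * (\<Phi> w / (w - x))) = (\<Sum>j. \<kappa> j * w ^ j) * \<Phi> w / (w - x)" by simp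
  qed
  from LIMSEQ_Suc[OF lim, unfolded this] have "(\<lambda>m. circ t (\<lambda>w. \<Sum>j<Suc m. \<kappa> j * w ^ j * (\<Phi> w / (w - x))))
      \<longlonglongrightarrow> circ t (\<lambda>w. (\<Sum>j. \<kappa> j * w ^ j) * \<Phi> w / (w - x))"
    .
  moreover have "(\<lambda>m. \<Sum>j<Suc m. \<kappa> j * x ^ j) \<longlonglongrightarrow> (\<Sum>j. \<kappa> j * x ^ j)"
    using summable_LIMSEQ[OF sm[of x]] x t by (intro LIMSEQ_Suc) auto
  ultimately have "A \<longlonglongrightarrow> (\<Sum>j. \<kappa> j * x ^ j) * \<phi> x - circ t (\<lambda>w. (\<Sum>j. \<kappa> j * w ^ j) * \<Phi> w / (w - x))"
    unfolding A_def by (intro tendsto_diff tendsto_mult tendsto_const)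
  from LIMSEQ_unique[OF this A0] show ?thesis by simp
qed

text \<open>The evaluation at 0 alone produces \<open>k\<close>; the bounds at the other points
  identify \<open>q \<phi>\<close> with a holomorphic \<open>a\<close>. The value
  \<open>q 0 = 1\<close> prevents \<open>q\<close> from vanishing identically, so it has finitely
  many zeros in each smaller disc.\<close>

lemma holomorphic_if_bounded_evaluations:
  assumes bound: "\<And>x. x \<in> ball 0 1 \<Longrightarrow> \<exists>M\<ge>0.
      \<forall>f \<in> module_M \<phi>. cmod (f x) \<le> M * (SUP w\<in>sphere 0 1. cmod (f w))"
  shows "\<phi> holomorphic_on ball 0 1"
proof -
  obtain M where M: "0 \<le> M"
    "\<And>f. f \<in> module_M \<phi> \<Longrightarrow> cmod (f 0) \<le> M * (SUP w\<in>sphere 0 1. cmod (f w))"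
    using bound[of 0] by auto
  obtain C where C: "\<And>n. cmod (moment n) \<le> C * \<rho> ^ n" using moment_bound by blast
  obtain k where k: "\<And>n. cmod (k n) \<le> M" "\<And>j. (\<lambda>n. k n * moment (Suc n + j)) sums moment j"
  proof (rule hankel_duality[OF rho_pos radii(3) M(1) C])
    show "cmod (\<Sum>j. b j * moment j) \<le> M * (\<Sum>n. cmod (\<Sum>j. b j * moment (Suc n + j)))"
      if "\<And>j. cmod (b j) \<le> B * \<rho> ^ j" for b B
      by (rule moment_estimate[OF M(2,1) that])
  qed (rule that)
  define \<kappa> where "\<kappa> j = (case j of 0 \<Rightarrow> 1 | Suc i \<Rightarrow> - k i)" for j
  define q where "q z = (\<Sum>j. \<kappa> j * z ^ j)" for z
  have "cmod (\<kappa> j) \<le> max M 1 * 1 ^ j" for j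
    using k(1) by (auto simp: \<kappa>_def max_def split: nat.split) (meson le_cases order_trans)+
  from power_series_geometric_holomorphic[OF this]
  have q: "q holomorphic_on ball 0 1" by (simp add: q_def [abs_def])
  have q0: "q 0 = 1"
    unfolding q_def by (subst suminf_finite[of "{0}"]) (auto simp: \<kappa>_def)
  \<comment> \<open>Holomorphy of \<open>q\<close> is known only inside the unit disc, so this
    splitting stops at outer radius 1.\<close>
  have "(\<lambda>w. q w * \<Phi> w) holomorphic_on annulus r1 1"
    by (intro holomorphic_on_mult holomorphic_on_subset[OF q] holomorphic_on_subset[OF hol]) (use radii in auto)
  then obtain a where a: "a holomorphic_on ball 0 1"
    and at: "\<And>x t. cmod x < t \<Longrightarrow> r1 < t \<Longrightarrow> t < 1 \<Longrightarrow> a x = circ t (\<lambda>w. q w * \<Phi> w / (w - x))"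
    by (rule annulus_split) ((use radii in linarith)+, rule that)
  have qa: "q x * \<phi> x = a x" if x: "x \<in> ball 0 1" for x
  proof -
    obtain t where t: "max r1 (cmod x) < t" "t < 1"
      using dense[of "max r1 (cmod x)" 1] x radii by auto
    obtain Mx where "0 \<le> Mx" "\<And>f. f \<in> module_M \<phi> \<Longrightarrow> cmod (f x) \<le> Mx * (SUP w\<in>sphere 0 1. cmod (f w))"
      using bound[OF x] by blast
    then show ?thesis
      using annihilated_multiplier[OF k _ _ _ _ _ \<kappa>_def, of x Mx t] at[of x t] t by (simp add: q_def)
  qed
  have "\<phi> field_differentiable at z" if z: "z \<in> ball 0 1" for z
  proof -
    obtain s where s: "cmod z < s" "s < 1" using dense[of "cmod z" 1] z by auto
    define Z where "Z = {w \<in> cball 0 s. q w = 0}"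
    have "finite Z"
    proof (cases "q constant_on ball 0 1")
      case True
      then have "q w = 1" if "w \<in> ball 0 1" for w
        using q0 that unfolding constant_on_def by (metis centre_in_ball zero_less_one)
      then have "Z = {}" using s by (auto simp: Z_def)
      then show ?thesis by simp
    next
      case False
      then show ?thesis
        unfolding Z_def using s by (intro holomorphic_compact_finite_zeros[OF q]) auto
    qed
    have "\<phi> holomorphic_on ball 0 s"
    proof (rule no_isolated_singularity[OF _ _ open_ball \<open>finite Z\<close>])
      show "continuous_on (ball 0 s) \<phi>" by (rule continuous_on_subset[OF cont]) (use s in auto)
      have "(\<lambda>w. a w / q w) holomorphic_on ball 0 s - Z"
        by (intro holomorphic_on_divide holomorphic_on_subset[OF a] holomorphic_on_subset[OF q])
          (use s in \<open>auto simp: Z_def\<close>)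
      then show "\<phi> holomorphic_on ball 0 s - Z"
      proof (rule holomorphic_transform)
        fix w assume w: "w \<in> ball 0 s - Z"
        then have "q w \<noteq> 0" "w \<in> ball 0 1" using s by (auto simp: Z_def)
        then show "a w / q w = \<phi> w" using qa[of w] by (simp add: divide_simps mult_ac)
      qed
    qed
    then show ?thesis using s by (auto simp: holomorphic_on_open field_differentiable_def)
  qed
  then show ?thesis by (auto simp: holomorphic_on_def intro: field_differentiable_at_within)
qed

end

section \<open>Real-analytic boundary values: reduction to the annulus setting\<close>

theorem theorem2:
  fixes \<phi> :: "complex \<Rightarrow> complex"
  assumes cont: "continuous_on (cball 0 1) \<phi>"
    and ran: "real_analytic (\<lambda>\<theta>. \<phi> (cis \<theta>))"
    and bound: "\<forall>x \<in> ball 0 1. \<exists>Mx :: real.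
        \<forall>f \<in> module_M \<phi>. cmod (f x) \<le> Mx * (SUP w\<in>sphere 0 1. cmod (f w))"
  shows "\<phi> holomorphic_on ball 0 1 \<and> (\<forall>f \<in> module_M \<phi>. f holomorphic_on ball 0 1)"
proof -
  obtain d \<Phi> where d: "0 < d" "d < 1"
    and \<Phi>: "\<Phi> holomorphic_on annulus (1 - d) (1 + d)" "\<And>z. z \<in> sphere 0 1 \<Longrightarrow> \<Phi> z = \<phi> z"
  proof (rule holomorphic_glue_sphere[of \<phi>])
    show "\<exists>e>0. \<exists>h. h holomorphic_on ball p e \<and> (\<forall>z \<in> sphere 0 1 \<inter> ball p e. h z = \<phi> z)"
      if "p \<in> sphere 0 1" for p
      by (rule real_analytic_local_extension[OF ran that])
  qed (rule that)
  \<comment> \<open>The radius \<open>\<rho>\<close> is taken midway between the inner radius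
    \<open>1 - d\<close> and the unit circle.\<close>
  interpret annulus_extension \<phi> \<Phi> "1 - d" "1 + d" "1 - d / 2"
    by unfold_locales (rule cont \<Phi> | use d in simp)+
  have "\<exists>M\<ge>0. \<forall>f \<in> module_M \<phi>. cmod (f x) \<le> M * (SUP w\<in>sphere 0 1. cmod (f w))" if "x \<in> ball 0 1" for x
  proof -
    from bound[rule_format, OF that]
    obtain Mx where Mx: "\<forall>f \<in> module_M \<phi>. cmod (f x) \<le> Mx * (SUP w\<in>sphere 0 1. cmod (f w))" ..
    \<comment> \<open>Passing to a nonnegative constant requires a nonnegative supremum; that
      follows from an upper bound for the moduli on the compact circle.\<close>
    have "cmod (f x) \<le> max Mx 0 * (SUP w\<in>sphere 0 1. cmod (f w))" if f: "f \<in> module_M \<phi>" for f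
    proof -
      have "continuous_on (cball 0 1) f"
        using f cont by (auto simp: module_M_def disk_algebra_def intro!: continuous_intros)
      then have "continuous_on (sphere 0 1) (\<lambda>w. cmod (f w))"
        by (intro continuous_on_norm) (auto intro: continuous_on_subset)
      then have "bdd_above ((\<lambda>w. cmod (f w)) ` sphere 0 1)"
        by (intro bounded_imp_bdd_above compact_imp_bounded compact_continuous_image) auto
      then have "cmod (f 1) \<le> (SUP w\<in>sphere 0 1. cmod (f w))" by (intro cSUP_upper) auto
      then have "0 \<le> (SUP w\<in>sphere 0 1. cmod (f w))" using norm_ge_zero order_trans by blast
      then have "Mx * (SUP w\<in>sphere 0 1. cmod (f w)) \<le> max Mx 0 * (SUP w\<in>sphere 0 1. cmod (f w))"
        by (intro mult_right_mono) auto
      with bspec[OF Mx f] show ?thesis by (rule order_trans)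
    qed
    then show ?thesis by (intro exI[of _ "max Mx 0"]) auto
  qed
  then have "\<phi> holomorphic_on ball 0 1" by (rule holomorphic_if_bounded_evaluations)
  then show ?thesis
    by (auto simp: module_M_def disk_algebra_def intro!: holomorphic_intros)
qed

end
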